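(* Let $\upsilon\ge1$ be an integer, $q>-1$ and $p$ real, $s\ge0$ an integer with $s<\frac{p-1}{2}$, $t\neq0$ and $w$ arbitrary real numbers. Then $${}_KN_{s;\upsilon}^{(p,q)}(t,w)=-\frac{\Gamma(p-s)\,t^s}{4\pi^2}\int_{-\infty}^{0^+}\int_{-\infty}^{0^+}e^{y_1+y_2}\,y_1^{2s-p}\,y_2^{-q-1}\left(1-\left(\frac{w}{y_2}\right)^{\upsilon}-\frac{1}{ty_1}\right)^{s}dy_1\,dy_2 .$$
   Context: $(a)_n$ is the Pochhammer symbol. The first set of finite bivariate biorthogonal N-Konhauser polynomials is $${}_KN_{s;\upsilon}^{(p,q)}(t,w)=\Gamma(p-s)\sum_{k=0}^{s}\sum_{m=0}^{s-k}\frac{(-s)_{k+m}\,t^{s-k}w^{\upsilon m}}{\Gamma(p-2s+k)\,\Gamma(q+1+\upsilon m)\,k!\,m!}.$$ $\int_{-\infty}^{0^+}$ denotes integration along a Hankel contour: it starts at $-\infty$ below the negative real axis, encircles the origin once counterclockwise, and returns to $-\infty$ above the negative real axis, with powers taken with $|\arg y|\le\pi$; with this convention $\frac1{\Gamma(z)}=\frac1{2\pi i}\int_{-\infty}^{0^+}e^uu^{-z}\,du$. *)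

theory Defs
  imports "HOL-Complex_Analysis.Complex_Analysis"
begin

definition N_Konhauser :: "nat \<Rightarrow> nat \<Rightarrow> real \<Rightarrow> real \<Rightarrow> real \<Rightarrow> real \<Rightarrow> real" where
  "N_Konhauser s \<upsilon> p q t w =
     Gamma (p - real s) *
     (\<Sum>k\<in>{0..s}. \<Sum>m\<in>{0..s - k}.
        pochhammer (- real s) (k + m) * t ^ (s - k) * w ^ (\<upsilon> * m) /
        (Gamma (p - 2 * real s + real k) * Gamma (q + 1 + real (\<upsilon> * m)) * fact k * fact m))"

text \<open>
  A Hankel contour, parametrised by the whole real line: a locally piecewise continuously
  differentiable curve off the cut \<open>(-\<infinity>, 0]\<close> whose argument runs from \<open>-\<pi>\<close> (start at \<open>-\<infinity>\<close> below
  the negative real axis) to \<open>\<pi>\<close> (return to \<open>-\<infinity>\<close> above it). As the curve avoids the cut, \<open>Arg\<close> is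
  continuous along it, so the two limits say that it encircles the origin once counterclockwise,
  and \<open>powr\<close> is the power with \<open>|arg y| \<le> \<pi>\<close>.
\<close>

definition hankel_contour :: "(real \<Rightarrow> complex) \<Rightarrow> bool" where
  "hankel_contour \<gamma> \<longleftrightarrow>
     (\<forall>a b. valid_path (subpath a b \<gamma>)) \<and>
     range \<gamma> \<inter> \<real>\<^sub>\<le>\<^sub>0 = {} \<and>
     filterlim \<gamma> at_infinity at_bot \<and>
     filterlim \<gamma> at_infinity at_top \<and>
     ((\<lambda>x. Arg (\<gamma> x)) \<longlongrightarrow> - pi) at_bot \<and>
     ((\<lambda>x. Arg (\<gamma> x)) \<longlongrightarrow> pi) at_top"

text \<open>
  Contour integrals along curves parametrised by the real line, as improper integrals in which
  the two ends of the truncated curve tend to infinity independently.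
\<close>

definition has_improper_contour_integral ::
    "(complex \<Rightarrow> complex) \<Rightarrow> complex \<Rightarrow> (real \<Rightarrow> complex) \<Rightarrow> bool"
    (infixr \<open>has'_improper'_contour'_integral\<close> 50) where
  "(f has_improper_contour_integral I) \<gamma> \<longleftrightarrow>
     (\<forall>a b. f contour_integrable_on subpath a b \<gamma>) \<and>
     ((\<lambda>(a, b). contour_integral (subpath a b \<gamma>) f) \<longlongrightarrow> I) (at_bot \<times>\<^sub>F at_top)"

definition improper_contour_integrable_on ::
    "(complex \<Rightarrow> complex) \<Rightarrow> (real \<Rightarrow> complex) \<Rightarrow> bool"
    (infixr \<open>improper'_contour'_integrable'_on\<close> 50) where
  "f improper_contour_integrable_on \<gamma> \<longleftrightarrow> (\<exists>I. (f has_improper_contour_integral I) \<gamma>)"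

definition improper_contour_integral ::
    "(real \<Rightarrow> complex) \<Rightarrow> (complex \<Rightarrow> complex) \<Rightarrow> complex" where
  "improper_contour_integral \<gamma> f = (THE I. (f has_improper_contour_integral I) \<gamma>)"

lemma improper_contour_integral_unique:
  assumes "(f has_improper_contour_integral I) \<gamma>"
  shows "improper_contour_integral \<gamma> f = I"
  unfolding improper_contour_integral_def
proof (rule the_equality)
  fix J assume "(f has_improper_contour_integral J) \<gamma>"
  moreover have "at_bot \<times>\<^sub>F at_top \<noteq> (bot :: (real \<times> real) filter)"
    by (simp add: prod_filter_eq_bot)
  ultimately show "J = I"
    using assms tendsto_unique unfolding has_improper_contour_integral_def by blast
qed (fact assms)

text \<open>Hankel contours exist: the square of the line \<open>Re z = 1\<close>, traversed upwards.\<close>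

lemma hankel_contour_parabola: "hankel_contour (\<lambda>x. (1 + \<i> * of_real x)\<^sup>2)"
proof -
  let ?z = "\<lambda>x. 1 + \<i> * complex_of_real x"
  have "valid_path (subpath a b (\<lambda>x. (?z x)\<^sup>2))" for a b
  proof -
    have "(\<lambda>x. (?z ((b - a) * x + a))\<^sup>2) C1_differentiable_on {0..1}"
      unfolding C1_differentiable_on_def
    proof (intro exI conjI ballI)
      fix x :: real
      show "((\<lambda>x. (?z ((b - a) * x + a))\<^sup>2) has_vector_derivative
              2 * ?z ((b - a) * x + a) * (\<i> * of_real (b - a))) (at x)"
        unfolding has_vector_derivative_def
        by (auto intro!: derivative_eq_intros simp: scaleR_conv_of_real algebra_simps)
    qed (intro continuous_intros)
    then show ?thesis
      by (simp add: subpath_def valid_path_def C1_differentiable_imp_piecewise)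
  qed
  moreover have cut: "(?z x)\<^sup>2 \<notin> \<real>\<^sub>\<le>\<^sub>0" for x
    by (auto simp: complex_nonpos_Reals_iff power2_eq_square)
  moreover have Arg: "Arg ((?z x)\<^sup>2) = 2 * arctan x" for x
  proof -
    have "Arg (?z x) = arctan x"
      by (subst arg_conv_arctan) auto
    moreover have "- pi < arctan x * 2" "arctan x * 2 < pi"
      using arctan_lbound[of x] arctan_ubound[of x] by linarith+
    moreover have "?z x \<noteq> 0"
      by (simp add: complex_eq_iff)
    ultimately show ?thesis
      by (simp add: power2_eq_square Arg_eq_Im_Ln Ln_times_simple)
  qed
  moreover have nrm: "norm ((?z x)\<^sup>2) = 1 + x\<^sup>2" for x
    by (simp add: norm_power cmod_power2)
  moreover have "filterlim (\<lambda>x. (?z x)\<^sup>2) at_infinity at_bot"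
    unfolding filterlim_at_infinity_conv_norm_at_top nrm
    by (intro filterlim_tendsto_add_at_top[OF tendsto_const] filterlim_pow_at_bot_even filterlim_ident) auto
  moreover have "filterlim (\<lambda>x. (?z x)\<^sup>2) at_infinity at_top"
    unfolding filterlim_at_infinity_conv_norm_at_top nrm
    by (intro filterlim_tendsto_add_at_top[OF tendsto_const] filterlim_pow_at_top filterlim_ident) auto
  moreover have "((\<lambda>x. 2 * arctan x) \<longlongrightarrow> - pi) at_bot"
    using tendsto_mult[OF tendsto_const[of 2] tendsto_arctan_at_bot] by simp
  moreover have "((\<lambda>x. 2 * arctan x) \<longlongrightarrow> pi) at_top"
    using tendsto_mult[OF tendsto_const[of 2] tendsto_arctan_at_top] by simp
  ultimately show ?thesis
    unfolding hankel_contour_def by auto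
qed

end

theory Submission
  imports Defs "HOL-Real_Asymp.Real_Asymp"
begin

text \<open>
  The identity is Hankel's formula for the reciprocal Gamma function, applied termwise. Expanding
  the \<open>s\<close>-th power of the trinomial turns the integrand into a finite sum of products
  \<open>c * (exp y\<^sub>1 * y\<^sub>1 powr (- a)) * (exp y\<^sub>2 * y\<^sub>2 powr (- b))\<close> with \<open>a = p - 2 s + k\<close> and
  \<open>b = q + 1 + \<upsilon> m\<close>. The iterated integral of such a product is \<open>c (2 \<pi> \<i>)\<^sup>2 / (\<Gamma>(a) \<Gamma>(b))\<close>, and
  \<open>(2 \<pi> \<i>)\<^sup>2 = - 4 \<pi>\<^sup>2\<close> explains the prefactor. Since \<open>0 powr a = 0\<close> and \<open>1 / 0 = 0\<close>, the expansion
  (lemmas \<open>trinomial_pochhammer\<close> and \<open>powr_divide_power\<close>) holds at every pair of points, even at the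
  origin, so that it can be used as an equation between functions.

  The analytic content is \<open>hankel_integral_rGamma\<close>: the integral of \<open>exp y * y powr (- z)\<close> along any
  Hankel contour is \<open>2 \<pi> \<i> / \<Gamma>(z)\<close>, for every complex \<open>z\<close>. The contour is arbitrary, so instead of
  deforming it the proof uses an antiderivative \<open>G\<close> on the plane cut along the negative real axis:
  the integral is the difference of the limits of \<open>G\<close> at the two ends of the contour.
  With \<open>c = 1 - z\<close> and an entire \<open>E\<close> given by a power series, \<open>G y = y powr c * E (- y)\<close>, and
  \<open>K u = u powr c * E u\<close> is an antiderivative of \<open>exp (- u) * u powr (c - 1)\<close>. On the upper and on the
  lower half-plane \<open>G y\<close> equals \<open>exp (\<plusminus> \<i> \<pi> c) * K (- y)\<close>. The reflection \<open>u = - y\<close> moves both ends of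
  the contour next to the positive real axis, which lies inside the cut plane. There, \<open>K\<close> has one and
  the same limit \<open>L\<close> at both ends, which is its limit along the positive reals. So the integral is
  \<open>2 \<i> sin (\<pi> c) L\<close>.

  For \<open>Re z < 1\<close> the limit \<open>L\<close> is Euler's integral for \<open>\<Gamma>(1 - z)\<close>, and the reflection formula gives
  the claim. For \<open>z = 1\<close> the antiderivative contains a logarithm, whose jump \<open>2 \<pi> \<i>\<close> across the cut
  is the value of the integral. Integration by parts passes from \<open>z \<noteq> 0\<close> to \<open>z + 1\<close>, just as
  \<open>1 / \<Gamma>(z + 1) = 1 / (z \<Gamma>(z))\<close>. It gives nothing at \<open>z = 0\<close>, which is why \<open>z = 1\<close> needs its own
  argument.
\<close>

section \<open>Improper contour integrals\<close>

lemma has_improper_contour_integral_cmult: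
  assumes "(f has_improper_contour_integral I) \<gamma>"
  shows "((\<lambda>y. k * f y) has_improper_contour_integral k * I) \<gamma>"
proof -
  have "((\<lambda>ab. k * contour_integral (subpath (fst ab) (snd ab) \<gamma>) f) \<longlongrightarrow> k * I) (at_bot \<times>\<^sub>F at_top)"
    using assms by (intro tendsto_mult_left) (simp add: has_improper_contour_integral_def case_prod_unfold)
  then show ?thesis
    using assms by (simp add: has_improper_contour_integral_def case_prod_unfold contour_integrable_lmul contour_integral_lmul)
qed

lemma has_improper_contour_integral_add:
  assumes "(f has_improper_contour_integral I) \<gamma>" "(g has_improper_contour_integral J) \<gamma>"
  shows "((\<lambda>y. f y + g y) has_improper_contour_integral I + J) \<gamma>"
proof -
  have "((\<lambda>ab. contour_integral (subpath (fst ab) (snd ab) \<gamma>) f +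
      contour_integral (subpath (fst ab) (snd ab) \<gamma>) g) \<longlongrightarrow> I + J) (at_bot \<times>\<^sub>F at_top)"
    using assms by (intro tendsto_add) (simp_all add: has_improper_contour_integral_def case_prod_unfold)
  then show ?thesis
    using assms by (simp add: has_improper_contour_integral_def case_prod_unfold contour_integrable_add contour_integral_add)
qed

lemma has_improper_contour_integral_sum:
  assumes "\<And>i. i \<in> A \<Longrightarrow> (f i has_improper_contour_integral I i) \<gamma>"
  shows "((\<lambda>y. \<Sum>i\<in>A. f i y) has_improper_contour_integral (\<Sum>i\<in>A. I i)) \<gamma>"
proof -
  have "((\<lambda>y. 0) has_improper_contour_integral 0) \<gamma>"
    by (auto simp: has_improper_contour_integral_def contour_integrable_on_def case_prod_unfold
        intro: has_contour_integral_0)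
  with assms show ?thesis
    by (induction A rule: infinite_finite_induct) (auto intro: has_improper_contour_integral_add)
qed

text \<open>
  On a truncated contour the integral is the difference of the end values of \<open>G\<close>, and the two ends
  move independently of each other. So only the behaviour of \<open>G\<close> at the ends matters, not the
  shape of the contour.
\<close>

lemma has_improper_contour_integral_primitive:
  assumes \<gamma>: "hankel_contour \<gamma>"
    and G: "\<And>y. y \<notin> \<real>\<^sub>\<le>\<^sub>0 \<Longrightarrow> (G has_field_derivative g y) (at y)"
    and A: "((\<lambda>x. G (\<gamma> x)) \<longlongrightarrow> A) at_bot" and B: "((\<lambda>x. G (\<gamma> x)) \<longlongrightarrow> B) at_top"
  shows "(g has_improper_contour_integral B - A) \<gamma>"
proof -
  have int: "(g has_contour_integral (G (\<gamma> b) - G (\<gamma> a))) (subpath a b \<gamma>)" for a b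
  proof -
    have "(g has_contour_integral (G (pathfinish (subpath a b \<gamma>)) - G (pathstart (subpath a b \<gamma>))))
        (subpath a b \<gamma>)"
    proof (rule contour_integral_primitive)
      show "(G has_field_derivative g y) (at y within - \<real>\<^sub>\<le>\<^sub>0)" if "y \<in> - \<real>\<^sub>\<le>\<^sub>0" for y
        using G that by (auto intro: has_field_derivative_at_within)
      show "valid_path (subpath a b \<gamma>)" "path_image (subpath a b \<gamma>) \<subseteq> - \<real>\<^sub>\<le>\<^sub>0"
        using \<gamma> by (auto simp: hankel_contour_def path_image_subpath_gen disjoint_iff)
    qed
    then show ?thesis by simp
  qed
  have "((\<lambda>ab. G (\<gamma> (snd ab)) - G (\<gamma> (fst ab))) \<longlongrightarrow> B - A) (at_bot \<times>\<^sub>F at_top)"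
    by (intro tendsto_diff filterlim_compose[OF A filterlim_fst] filterlim_compose[OF B filterlim_snd])
  then show ?thesis
    using int unfolding has_improper_contour_integral_def case_prod_unfold contour_integral_unique[OF int]
    by (auto simp: contour_integrable_on_def)
qed

text \<open>
  The constant \<open>1 / 2\<close> stands for any number below \<open>1\<close>: the cosine of the argument tends to \<open>- 1\<close>.
  The bound makes \<open>exp\<close> decay exponentially in the modulus along both ends, and the sign of the
  imaginary part tells on which side of the cut an end lies.
\<close>

lemma hankel_contour_ends:
  assumes "hankel_contour \<gamma>"
  shows "\<forall>\<^sub>F x in at_top. 0 < Im (\<gamma> x) \<and> norm (\<gamma> x) / 2 \<le> - Re (\<gamma> x)"
    and "\<forall>\<^sub>F x in at_bot. Im (\<gamma> x) < 0 \<and> norm (\<gamma> x) / 2 \<le> - Re (\<gamma> x)"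
proof -
  have cos: "\<forall>\<^sub>F x in F. norm (\<gamma> x) / 2 \<le> - Re (\<gamma> x)"
    if "((\<lambda>x. Arg (\<gamma> x)) \<longlongrightarrow> \<theta>) F" "cos \<theta> = - 1" for F \<theta>
  proof -
    have "((\<lambda>x. cos (Arg (\<gamma> x))) \<longlongrightarrow> - 1) F"
      using tendsto_cos[OF that(1)] that(2) by simp
    then have "\<forall>\<^sub>F x in F. cos (Arg (\<gamma> x)) < - 1 / 2"
      by (rule order_tendstoD) simp
    then show ?thesis
    proof eventually_elim
      case (elim x)
      have "Re (\<gamma> x) = norm (\<gamma> x) * cos (Arg (\<gamma> x))"
        by (metis Re_rcis rcis_cmod_Arg)
      also have "\<dots> \<le> norm (\<gamma> x) * (- 1 / 2)"
        using elim by (intro mult_left_mono) auto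
      finally show ?case by simp
    qed
  qed
  have top: "((\<lambda>x. Arg (\<gamma> x)) \<longlongrightarrow> pi) at_top" and bot: "((\<lambda>x. Arg (\<gamma> x)) \<longlongrightarrow> - pi) at_bot"
    and cut: "\<gamma> x \<notin> \<real>\<^sub>\<le>\<^sub>0" for x
    using assms by (auto simp: hankel_contour_def disjoint_iff)
  \<comment> \<open>The argument \<open>\<pi>\<close> itself belongs to the cut, so near the upper end it stays strictly below \<open>\<pi>\<close>.\<close>
  have "\<forall>\<^sub>F x in at_top. 0 < Arg (\<gamma> x)"
    using order_tendstoD(1)[OF top, of 0] by simp
  then show "\<forall>\<^sub>F x in at_top. 0 < Im (\<gamma> x) \<and> norm (\<gamma> x) / 2 \<le> - Re (\<gamma> x)"
    using cos[OF top cos_pi]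
  proof eventually_elim
    case (elim x)
    have "Arg (\<gamma> x) \<noteq> pi"
      using cut[of x] by (auto simp: Arg_eq_pi_iff complex_is_Real_iff complex_nonpos_Reals_iff Arg_eq_pi)
    then show ?case
      using elim Arg_le_pi[of "\<gamma> x"] Arg_lt_pi[of "\<gamma> x"] by auto
  qed
  have "\<forall>\<^sub>F x in at_bot. Arg (\<gamma> x) < 0"
    using order_tendstoD(2)[OF bot, of 0] by simp
  then show "\<forall>\<^sub>F x in at_bot. Im (\<gamma> x) < 0 \<and> norm (\<gamma> x) / 2 \<le> - Re (\<gamma> x)"
    using cos[OF bot, simplified]
  proof eventually_elim
    case (elim x)
    then show ?case by (auto simp: Arg_neg_iff)
  qed
qed

section \<open>Limits at infinity\<close>

lemma norm_powr_le:
  assumes "v \<noteq> 0"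
  shows "norm (v powr z) \<le> exp (pi * \<bar>Im z\<bar>) * norm v powr Re z"
proof -
  have "- Im z * Arg v \<le> \<bar>Im z\<bar> * \<bar>Arg v\<bar>"
    by (metis abs_ge_self abs_minus_cancel abs_mult mult_minus_left)
  also have "\<dots> \<le> \<bar>Im z\<bar> * pi"
    using Arg_bounded[of v] by (intro mult_left_mono) auto
  finally show ?thesis
    using assms by (simp add: norm_powr_complex mult.commute[of "exp _"] mult_left_mono mult.commute[of pi])
qed

lemma sector_decay:
  "((\<lambda>v. exp (- norm v / 2) * norm v powr a) \<longlongrightarrow> 0) at_infinity"
proof -
  have "((\<lambda>r::real. exp (- r / 2) * r powr a) \<longlongrightarrow> 0) at_top"
    by real_asymp
  from filterlim_compose[OF this filterlim_norm_at_top] show ?thesis by simp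
qed

lemma tendsto_exp_powr_0:
  assumes h: "filterlim h at_infinity F" and sector: "\<forall>\<^sub>F x in F. norm (h x) / 2 \<le> - Re (h x)"
  shows "((\<lambda>x. exp (h x) * h x powr z) \<longlongrightarrow> 0) F"
proof (rule Lim_null_comparison)
  have "((\<lambda>x. exp (pi * \<bar>Im z\<bar>) * (exp (- norm (h x) / 2) * norm (h x) powr Re z))
      \<longlongrightarrow> exp (pi * \<bar>Im z\<bar>) * 0) F"
    by (intro tendsto_mult_left filterlim_compose[OF sector_decay h])
  then show "((\<lambda>x. exp (pi * \<bar>Im z\<bar>) * (exp (- norm (h x) / 2) * norm (h x) powr Re z)) \<longlongrightarrow> 0) F"
    by simp
  show "\<forall>\<^sub>F x in F. norm (exp (h x) * h x powr z) \<le>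
      exp (pi * \<bar>Im z\<bar>) * (exp (- norm (h x) / 2) * norm (h x) powr Re z)"
    using sector
  proof eventually_elim
    case (elim x)
    show ?case
    proof (cases "h x = 0")
      case False
      then have "norm (exp (h x)) * norm (h x powr z) \<le>
          exp (- norm (h x) / 2) * (exp (pi * \<bar>Im z\<bar>) * norm (h x) powr Re z)"
        using elim by (intro mult_mono norm_powr_le) (auto simp: norm_exp_eq_Re)
      then show ?thesis
        by (simp add: norm_mult mult_ac)
    qed simp
  qed
qed

text \<open>
  A point \<open>u\<close> of the sector and the positive real number \<open>norm u\<close> are joined by a segment of length at
  most \<open>2 * norm u\<close> on which the derivative is exponentially small in \<open>norm u\<close>. Hence the limit of
  \<open>K\<close> along the positive reals is its limit along every path to infinity inside the sector.
\<close>

lemma tendsto_primitive_sector: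
  fixes K :: "complex \<Rightarrow> complex"
  assumes K: "\<And>u. u \<notin> \<real>\<^sub>\<le>\<^sub>0 \<Longrightarrow> (K has_field_derivative exp (- u) * u powr z) (at u)"
    and L: "((\<lambda>r. K (of_real r)) \<longlongrightarrow> L) at_top"
    and h: "filterlim h at_infinity F" and sector: "\<forall>\<^sub>F x in F. norm (h x) / 2 \<le> Re (h x)"
  shows "((\<lambda>x. K (h x)) \<longlongrightarrow> L) F"
proof -
  define C where "C = 2 * exp (pi * \<bar>Im z\<bar>)"
  have bound: "norm (K u - K (of_real (norm u))) \<le> C * (exp (- norm u / 2) * norm u powr (\<bar>Re z\<bar> + 1))"
    if u: "norm u / 2 \<le> Re u" "2 \<le> norm u" for u
  proof -
    \<comment> \<open>A convex set that contains \<open>u\<close> and \<open>norm u\<close> and on which the integrand is exponentially small.\<close>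
    define S where "S = cball 0 (norm u) \<inter> {v. norm u / 2 \<le> Re v}"
    have "norm (K u - K (of_real (norm u))) \<le>
        (exp (- norm u / 2) * (exp (pi * \<bar>Im z\<bar>) * norm u powr \<bar>Re z\<bar>)) * norm (u - of_real (norm u))"
    proof (rule field_differentiable_bound)
      show "convex S"
        unfolding S_def by (intro convex_Int convex_cball convex_halfspace_Re_ge)
      show "u \<in> S" "complex_of_real (norm u) \<in> S"
        using u by (auto simp: S_def)
      fix v assume v: "v \<in> S"
      then have Re: "1 \<le> Re v" "norm u / 2 \<le> Re v" and le: "norm v \<le> norm u"
        using u by (auto simp: S_def)
      then have v1: "1 \<le> norm v"
        using complex_Re_le_cmod[of v] by linarith
      show "(K has_field_derivative exp (- v) * v powr z) (at v within S)"
        using Re by (intro has_field_derivative_at_within[OF K]) (auto simp: complex_nonpos_Reals_iff)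
      have "norm (v powr z) \<le> exp (pi * \<bar>Im z\<bar>) * norm v powr Re z"
        using v1 by (intro norm_powr_le) auto
      also have "norm v powr Re z \<le> norm v powr \<bar>Re z\<bar>"
        using v1 by (intro powr_mono) auto
      also have "\<dots> \<le> norm u powr \<bar>Re z\<bar>"
        using le by (intro powr_mono2) auto
      finally have "norm (v powr z) \<le> exp (pi * \<bar>Im z\<bar>) * norm u powr \<bar>Re z\<bar>"
        by simp
      moreover have "norm (exp (- v)) \<le> exp (- norm u / 2)"
        using Re by (simp add: norm_exp_eq_Re)
      ultimately show "norm (exp (- v) * v powr z) \<le>
          exp (- norm u / 2) * (exp (pi * \<bar>Im z\<bar>) * norm u powr \<bar>Re z\<bar>)"
        unfolding norm_mult by (intro mult_mono) auto
    qed
    also have "\<dots> \<le> (exp (- norm u / 2) * (exp (pi * \<bar>Im z\<bar>) * norm u powr \<bar>Re z\<bar>)) * (2 * norm u)"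
      using norm_triangle_ineq4[of u "of_real (norm u)"] by (intro mult_left_mono) simp_all
    also have "\<dots> = C * (exp (- norm u / 2) * norm u powr (\<bar>Re z\<bar> + 1))"
    proof -
      have "norm u powr (\<bar>Re z\<bar> + 1) = norm u powr \<bar>Re z\<bar> * norm u"
        using u by (subst powr_add) simp
      then show ?thesis
        by (simp only: C_def mult_ac)
    qed
    finally show ?thesis .
  qed
  have norm_h: "filterlim (\<lambda>x. norm (h x)) at_top F"
    using h by (simp add: filterlim_at_infinity_conv_norm_at_top)
  then have "\<forall>\<^sub>F x in F. 2 \<le> norm (h x)"
    by (simp add: filterlim_at_top)
  with sector have "\<forall>\<^sub>F x in F. norm (K (h x) - K (of_real (norm (h x)))) \<le>
      C * (exp (- norm (h x) / 2) * norm (h x) powr (\<bar>Re z\<bar> + 1))"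
    by eventually_elim (rule bound)
  moreover have "((\<lambda>x. C * (exp (- norm (h x) / 2) * norm (h x) powr (\<bar>Re z\<bar> + 1))) \<longlongrightarrow> 0) F"
    by (intro tendsto_mult_right_zero filterlim_compose[OF sector_decay h])
  ultimately have "((\<lambda>x. K (h x) - K (of_real (norm (h x)))) \<longlongrightarrow> 0) F"
    by (rule Lim_null_comparison)
  from tendsto_add[OF this filterlim_compose[OF L norm_h]] show ?thesis by simp
qed

lemma tendsto_has_integral_atLeast:
  fixes f :: "real \<Rightarrow> 'a :: banach"
  assumes "(f has_integral I) {a..}"
  shows "((\<lambda>R. integral {a..R} f) \<longlongrightarrow> I) at_top"
proof (rule tendstoI)
  fix e :: real assume "0 < e"
  with assms obtain B where
    B: "\<And>c d. ball 0 B \<subseteq> cbox c d \<Longrightarrow> norm (integral (cbox c d) (\<lambda>x. if x \<in> {a..} then f x else 0) - I) < e"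
    unfolding has_integral_alt' by metis
  show "\<forall>\<^sub>F R in at_top. dist (integral {a..R} f) I < e"
    using eventually_ge_at_top[of "max B \<bar>a\<bar>"]
  proof eventually_elim
    case (elim R)
    have "ball 0 B \<subseteq> cbox (- R) R" "{a..} \<inter> cbox (- R) R = {a..R}"
      using elim by (auto simp: dist_real_def)
    with B[of "- R" R] show ?case
      by (simp only: dist_norm Henstock_Kurzweil_Integration.integral_restrict_Int)
  qed
qed

lemma tendsto_antiderivative_at_top:
  fixes f K :: "real \<Rightarrow> 'a :: banach"
  assumes f: "(f has_integral I) {a..}"
    and K: "continuous_on {a..} K" "\<And>x. a < x \<Longrightarrow> (K has_vector_derivative f x) (at x)"
  shows "(K \<longlongrightarrow> K a + I) at_top"
proof (rule Lim_transform_eventually)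
  show "((\<lambda>R. K a + integral {a..R} f) \<longlongrightarrow> K a + I) at_top"
    using f by (intro tendsto_intros tendsto_has_integral_atLeast)
  show "\<forall>\<^sub>F R in at_top. K a + integral {a..R} f = K R"
    using eventually_ge_at_top[of a]
  proof eventually_elim
    case (elim R)
    have "(f has_integral K R - K a) {a..R}"
      using elim K by (intro fundamental_theorem_of_calculus_interior) (auto intro: continuous_on_subset)
    then show ?case by (simp add: integral_unique)
  qed
qed

section \<open>Hankel's formula for the reciprocal Gamma function\<close>

text \<open>
  Comparing coefficients in \<open>c E + u E' = exp (- u)\<close> determines the \<open>n\<close>-th coefficient of \<open>E\<close> as
  \<open>(-1)\<^sup>n / (n! (n + c))\<close>. The equation says that \<open>u powr c * E u\<close> is an antiderivative of
  \<open>exp (- u) * u powr (c - 1)\<close>, a form of the lower incomplete Gamma function. For \<open>c = 0\<close> the constant term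
  of \<open>exp (- u)\<close> cannot be matched. It is subtracted here, and in the antiderivative it will
  contribute a logarithm.
\<close>

lemma power_series_exp_Euler_ode:
  fixes c :: complex
  assumes "Re c \<ge> 0"
  obtains E E' :: "complex \<Rightarrow> complex"
  where "\<And>u. (E has_field_derivative E' u) (at u)"
    and "\<And>u. c * E u + u * E' u = exp (- u) - (if c = 0 then 1 else 0)"
proof -
  \<comment> \<open>If \<open>c = 0\<close>, then \<open>a 0 = 0\<close> by division by zero: the constant term drops out, and the right-hand
    side of the equation is corrected by \<open>1\<close>.\<close>
  define a :: "nat \<Rightarrow> complex" where "a n = (- 1) ^ n / (fact n * (of_nat n + c))" for n
  have summable: "summable (\<lambda>n. a n * u ^ n)" for u
  proof (rule summable_comparison_test'[of "\<lambda>n. norm u ^ n / fact n" 1])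
    show "summable (\<lambda>n. norm u ^ n / fact n)"
      using summable_exp_generic[of "norm u"] by (simp add: field_simps)
    show "norm (a n * u ^ n) \<le> norm u ^ n / fact n" if "1 \<le> n" for n
    proof -
      have "1 \<le> Re (of_nat n + c)"
        using that assms by simp
      also have "\<dots> \<le> norm (of_nat n + c)"
        by (rule complex_Re_le_cmod)
      finally have "1 \<le> norm (of_nat n + c)" .
      then have "norm (a n) \<le> 1 / fact n"
        by (simp add: a_def norm_divide norm_mult norm_power divide_simps)
      then have "norm (a n) * norm u ^ n \<le> 1 / fact n * norm u ^ n"
        by (intro mult_right_mono) auto
      then show ?thesis
        by (simp add: norm_mult norm_power)
    qed
  qed
  define E where "E u = (\<Sum>n. a n * u ^ n)" for u
  define E' where "E' u = (\<Sum>n. diffs a n * u ^ n)" for u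
  show thesis
  proof
    show "(E has_field_derivative E' u) (at u)" for u
      unfolding E_def[abs_def] E'_def using summable by (rule termdiffs_strong_converges_everywhere)
    show "c * E u + u * E' u = exp (- u) - (if c = 0 then 1 else 0)" for u
    proof -
      have "summable (\<lambda>n. diffs a n * u ^ n)"
        using summable by (intro termdiff_converges_all)
      then have "(\<lambda>n. u * (of_nat n * a n * u ^ (n - Suc 0))) sums (u * E' u)"
        unfolding E'_def by (intro sums_mult diffs_equiv)
      moreover have "(\<lambda>n. c * (a n * u ^ n)) sums (c * E u)"
        unfolding E_def using summable by (intro sums_mult summable_sums)
      ultimately have
        "(\<lambda>n. c * (a n * u ^ n) + u * (of_nat n * a n * u ^ (n - Suc 0))) sums (c * E u + u * E' u)"
        by (intro sums_add)
      moreover have "c * (a n * u ^ n) + u * (of_nat n * a n * u ^ (n - Suc 0)) =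
          (- u) ^ n /\<^sub>R fact n - (if n = 0 then if c = 0 then 1 else 0 else 0)" for n
      proof (cases n)
        case 0
        then show ?thesis by (simp add: a_def)
      next
        case (Suc m)
        have "Re (of_nat n + c) > 0"
          using Suc assms by simp
        then have "of_nat n + c \<noteq> 0"
          by (metis less_irrefl zero_complex.sel(1))
        then have "(of_nat n + c) * a n = (- 1) ^ n / fact n"
          by (simp add: a_def)
        moreover have "c * (a n * u ^ n) + u * (of_nat n * a n * u ^ (n - Suc 0)) =
            ((of_nat n + c) * a n) * u ^ n"
          using Suc by (simp add: algebra_simps)
        ultimately show ?thesis
          using Suc by (simp add: scaleR_conv_of_real power_minus[of u] field_simps)
      qed
      moreover have "(\<lambda>n. (- u) ^ n /\<^sub>R fact n - (if n = 0 then if c = 0 then 1 else 0 else 0)) sums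
          (exp (- u) - (if c = 0 then 1 else 0))"
        by (intro sums_diff exp_converges sums_single)
      ultimately show ?thesis
        by (simp add: sums_unique2)
    qed
  qed
qed

lemma Ln_minus_Im_pos:
  assumes "0 < Im y" shows "Ln y = Ln (- y) + \<i> * of_real pi"
  using assms by (subst Ln_minus) auto

lemma Ln_minus_Im_neg:
  assumes "Im y < 0" shows "Ln y = Ln (- y) - \<i> * of_real pi"
  using assms by (subst Ln_minus) auto

text \<open>
  The jump across the cut: \<open>G\<close> integrates \<open>exp y * y powr (c - 1)\<close>, and it differs from \<open>K (- y)\<close> by the
  factor \<open>exp (\<i> \<pi> c)\<close> above the real axis and by \<open>exp (- \<i> \<pi> c)\<close> below it. Because \<open>K (- y)\<close> has
  the limit \<open>L\<close> at both ends, only the difference of these factors remains. If \<open>c = 0\<close>,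
  both factors are \<open>1\<close>, and the logarithm supplies the jump instead.
\<close>

lemma hankel_integral_from_real_limit:
  fixes c :: complex and E E' :: "complex \<Rightarrow> complex"
  defines "K \<equiv> \<lambda>u. u powr c * E u + (if c = 0 then Ln u else 0)"
  assumes \<gamma>: "hankel_contour \<gamma>"
    and E: "\<And>u. (E has_field_derivative E' u) (at u)"
    and ode: "\<And>u. c * E u + u * E' u = exp (- u) - (if c = 0 then 1 else 0)"
    and L: "((\<lambda>r. K (of_real r)) \<longlongrightarrow> L) at_top"
  shows "((\<lambda>y. exp y * y powr (c - 1)) has_improper_contour_integral
           2 * \<i> * sin (of_real pi * c) * L + (if c = 0 then 2 * of_real pi * \<i> else 0)) \<gamma>"
proof -
  define G where "G y = y powr c * E (- y) + (if c = 0 then Ln y else 0)" for y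
  have powr: "v powr c = v powr (c - 1) * v" if "v \<noteq> 0" for v
    using that by (simp add: powr_diff)
  have Ln: "((\<lambda>v. if c = 0 then Ln v else 0) has_field_derivative (if c = 0 then 1 / v else 0)) (at v)"
    if "v \<notin> \<real>\<^sub>\<le>\<^sub>0" for v
    using that by (auto intro!: derivative_eq_intros simp: field_simps)
  have K_deriv: "(K has_field_derivative exp (- u) * u powr (c - 1)) (at u)" if u: "u \<notin> \<real>\<^sub>\<le>\<^sub>0" for u
  proof -
    have "u \<noteq> 0" using u by auto
    have "(K has_field_derivative
        (c * u powr (c - 1) * E u + E' u * u powr c + (if c = 0 then 1 / u else 0))) (at u)"
      unfolding K_def by (intro DERIV_add DERIV_mult has_field_derivative_powr E u Ln)
    moreover have "c * u powr (c - 1) * E u + E' u * u powr c + (if c = 0 then 1 / u else 0) =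
        u powr (c - 1) * (c * E u + u * E' u) + (if c = 0 then 1 / u else 0)"
      using powr[OF \<open>u \<noteq> 0\<close>] by (simp add: algebra_simps)
    ultimately show ?thesis
      using \<open>u \<noteq> 0\<close> by (auto simp: ode algebra_simps powr_minus_divide split: if_splits)
  qed
  have G_deriv: "(G has_field_derivative exp y * y powr (c - 1)) (at y)" if y: "y \<notin> \<real>\<^sub>\<le>\<^sub>0" for y
  proof -
    have "y \<noteq> 0" using y by auto
    have "((\<lambda>y. E (- y)) has_field_derivative - E' (- y)) (at y)"
      using DERIV_chain'[OF DERIV_minus[OF DERIV_ident] E, of y] by simp
    then have "(G has_field_derivative
        (c * y powr (c - 1) * E (- y) + - E' (- y) * y powr c + (if c = 0 then 1 / y else 0))) (at y)"
      unfolding G_def by (intro DERIV_add DERIV_mult has_field_derivative_powr y Ln)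
    moreover have "c * y powr (c - 1) * E (- y) + - E' (- y) * y powr c + (if c = 0 then 1 / y else 0) =
        y powr (c - 1) * (c * E (- y) + (- y) * E' (- y)) + (if c = 0 then 1 / y else 0)"
      using powr[OF \<open>y \<noteq> 0\<close>] by (simp add: algebra_simps)
    moreover have "\<dots> = exp y * y powr (c - 1)"
      using \<open>y \<noteq> 0\<close> by (simp only: ode) (auto simp: algebra_simps powr_minus_divide)
    ultimately show ?thesis
      by simp
  qed
  have lim: "((\<lambda>x. K (- \<gamma> x)) \<longlongrightarrow> L) F"
    if "filterlim \<gamma> at_infinity F" "\<forall>\<^sub>F x in F. norm (\<gamma> x) / 2 \<le> - Re (\<gamma> x)" for F
    using that by (intro tendsto_primitive_sector[OF K_deriv L])
      (simp_all add: filterlim_at_infinity_conv_norm_at_top)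
  have inf: "filterlim \<gamma> at_infinity at_top" "filterlim \<gamma> at_infinity at_bot"
    using \<gamma> by (auto simp: hankel_contour_def)
  have top: "((\<lambda>x. G (\<gamma> x)) \<longlongrightarrow> exp (\<i> * of_real pi * c) * L + (if c = 0 then \<i> * of_real pi else 0)) at_top"
  proof (rule Lim_transform_eventually)
    show "((\<lambda>x. exp (\<i> * of_real pi * c) * K (- \<gamma> x) + (if c = 0 then \<i> * of_real pi else 0)) \<longlongrightarrow>
        exp (\<i> * of_real pi * c) * L + (if c = 0 then \<i> * of_real pi else 0)) at_top"
      using hankel_contour_ends(1)[OF \<gamma>] by (intro tendsto_intros lim inf) (auto elim: eventually_mono)
    show "\<forall>\<^sub>F x in at_top. exp (\<i> * of_real pi * c) * K (- \<gamma> x) + (if c = 0 then \<i> * of_real pi else 0) = G (\<gamma> x)"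
      using hankel_contour_ends(1)[OF \<gamma>]
    proof eventually_elim
      case (elim x)
      then have "\<gamma> x \<noteq> 0" by auto
      have "\<gamma> x powr c = exp (\<i> * of_real pi * c) * (- \<gamma> x) powr c"
        using elim \<open>\<gamma> x \<noteq> 0\<close> by (simp add: powr_def Ln_minus_Im_pos algebra_simps flip: exp_add)
      with elim show ?case
        by (simp add: G_def K_def Ln_minus_Im_pos algebra_simps)
    qed
  qed
  have bot: "((\<lambda>x. G (\<gamma> x)) \<longlongrightarrow> exp (- (\<i> * of_real pi * c)) * L - (if c = 0 then \<i> * of_real pi else 0)) at_bot"
  proof (rule Lim_transform_eventually)
    show "((\<lambda>x. exp (- (\<i> * of_real pi * c)) * K (- \<gamma> x) - (if c = 0 then \<i> * of_real pi else 0)) \<longlongrightarrow>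
        exp (- (\<i> * of_real pi * c)) * L - (if c = 0 then \<i> * of_real pi else 0)) at_bot"
      using hankel_contour_ends(2)[OF \<gamma>] by (intro tendsto_intros lim inf) (auto elim: eventually_mono)
    show "\<forall>\<^sub>F x in at_bot. exp (- (\<i> * of_real pi * c)) * K (- \<gamma> x) - (if c = 0 then \<i> * of_real pi else 0) = G (\<gamma> x)"
      using hankel_contour_ends(2)[OF \<gamma>]
    proof eventually_elim
      case (elim x)
      then have "\<gamma> x \<noteq> 0" by auto
      have "\<gamma> x powr c = exp (- (\<i> * of_real pi * c)) * (- \<gamma> x) powr c"
        using elim \<open>\<gamma> x \<noteq> 0\<close> by (simp add: powr_def Ln_minus_Im_neg algebra_simps flip: exp_add)
      with elim show ?case
        by (simp add: G_def K_def Ln_minus_Im_neg algebra_simps)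
    qed
  qed
  have sin: "2 * \<i> * sin (of_real pi * c) = exp (\<i> * of_real pi * c) - exp (- (\<i> * of_real pi * c))"
    by (simp add: sin_exp_eq mult_ac)
  have "exp (\<i> * of_real pi * c) * L + (if c = 0 then \<i> * of_real pi else 0) -
      (exp (- (\<i> * of_real pi * c)) * L - (if c = 0 then \<i> * of_real pi else 0)) =
      2 * \<i> * sin (of_real pi * c) * L + (if c = 0 then 2 * of_real pi * \<i> else 0)"
    unfolding sin left_diff_distrib by simp
  with has_improper_contour_integral_primitive[OF \<gamma> G_deriv bot top] show ?thesis
    by metis
qed

text \<open>
  For \<open>Re c > 0\<close> the antiderivative \<open>u powr c * E u\<close> is continuous at \<open>0\<close> with value \<open>0\<close>, so its
  limit at infinity is Euler's integral for \<open>Gamma c\<close>. The factor \<open>sin (\<pi> c)\<close> converts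
  \<open>Gamma (1 - z)\<close> into \<open>rGamma z\<close> by the reflection formula.
\<close>

lemma hankel_integral_Re_less_1:
  fixes z :: complex
  assumes \<gamma>: "hankel_contour \<gamma>" and z: "Re z < 1"
  shows "((\<lambda>y. exp y * y powr (- z)) has_improper_contour_integral 2 * of_real pi * \<i> * rGamma z) \<gamma>"
proof -
  define c where "c = 1 - z"
  have c: "0 < Re c" "c \<noteq> 0" using z by (auto simp: c_def)
  obtain E E' where E: "\<And>u. (E has_field_derivative E' u) (at u)"
    and ode: "\<And>u. c * E u + u * E' u = exp (- u) - (if c = 0 then 1 else 0)"
    using power_series_exp_Euler_ode[of c] c by auto
  have "((\<lambda>r. of_real r powr c * E (of_real r)) \<longlongrightarrow> of_real 0 powr c * E (of_real 0) + Gamma c) at_top"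
  proof (rule tendsto_antiderivative_at_top)
    show "((\<lambda>t. of_real t powr (c - 1) / of_real (exp t)) has_integral Gamma c) {0..}"
      using c by (intro Gamma_integral_complex)
    have "continuous_on UNIV E"
      by (auto intro!: continuous_at_imp_continuous_on DERIV_isCont E)
    then have "continuous_on {0..} (\<lambda>r. E (complex_of_real r))"
      by (rule continuous_on_compose2) (auto intro: continuous_intros)
    then show "continuous_on {0..} (\<lambda>r. of_real r powr c * E (of_real r))"
      using c by (intro continuous_intros) auto
    fix x :: real assume x: "0 < x"
    have "((\<lambda>u. u powr c * E u) has_field_derivative
        (c * of_real x powr (c - 1) * E (of_real x) + E' (of_real x) * of_real x powr c)) (at (of_real x))"
      using x by (auto intro!: derivative_eq_intros E simp: field_simps)
    moreover have "of_real x powr c = of_real x powr (c - 1) * of_real x"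
      using x by (simp add: powr_diff)
    then have "c * of_real x powr (c - 1) * E (of_real x) + E' (of_real x) * of_real x powr c =
        of_real x powr (c - 1) * (c * E (of_real x) + of_real x * E' (of_real x))"
      by (simp add: algebra_simps)
    ultimately show "((\<lambda>r. of_real r powr c * E (of_real r)) has_vector_derivative
        of_real x powr (c - 1) / of_real (exp x)) (at x)"
      using c by (intro has_vector_derivative_real_field) (simp add: ode exp_minus exp_of_real divide_inverse)
  qed
  then have "((\<lambda>r. of_real r powr c * E (of_real r) + (if c = 0 then Ln (of_real r) else 0)) \<longlongrightarrow> Gamma c) at_top"
    using c by simp
  from hankel_integral_from_real_limit[OF \<gamma> E ode this]
  have "((\<lambda>y. exp y * y powr (- z)) has_improper_contour_integral 2 * \<i> * sin (of_real pi * c) * Gamma c) \<gamma>"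
    using c by (simp add: c_def)
  moreover have "sin (of_real pi * c) * Gamma c = of_real pi * rGamma z"
  proof -
    have "rGamma c \<noteq> 0"
      using c by (auto simp: rGamma_eq_zero_iff elim!: nonpos_Ints_cases')
    moreover have "sin (of_real pi * c) = of_real pi * (rGamma c * rGamma z)"
      using rGamma_reflection_complex[of c] by (simp add: c_def)
    ultimately show ?thesis
      by (simp add: Gamma_def)
  qed
  then have "2 * \<i> * sin (of_real pi * c) * Gamma c = 2 * of_real pi * \<i> * rGamma z"
    by (simp add: mult_ac)
  ultimately show ?thesis
    by simp
qed

lemma hankel_integral_1:
  assumes \<gamma>: "hankel_contour \<gamma>"
  shows "((\<lambda>y. exp y * y powr (- 1)) has_improper_contour_integral 2 * of_real pi * \<i>) \<gamma>"
proof -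
  obtain E E' :: "complex \<Rightarrow> complex" where E: "\<And>u. (E has_field_derivative E' u) (at u)"
    and ode: "\<And>u. 0 * E u + u * E' u = exp (- u) - (if 0 = (0::complex) then 1 else 0)"
    using power_series_exp_Euler_ode[of 0] by auto
  define k where "k r = exp (- complex_of_real r) / of_real r" for r
  \<comment> \<open>Existence of a limit is enough: it gets multiplied by \<open>sin 0\<close>.\<close>
  have "k integrable_on {1..}"
  proof (rule integrable_on_all_intervals_integrable_bound)
    fix a b :: real
    have "k integrable_on {max 1 a..b}"
      unfolding k_def by (intro integrable_continuous_real continuous_intros) auto
    moreover have "{1..} \<inter> {a..b} = {max 1 a..b}" by auto
    ultimately show "(\<lambda>x. if x \<in> {1..} then k x else 0) integrable_on cbox a b"
      by (simp add: integrable_restrict_Int del: atLeast_iff)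
  next
    show "(\<lambda>x::real. exp (- 1 * x)) integrable_on {1..}"
      by (rule integrable_on_exp_minus_to_infinity) simp
    show "norm (k x) \<le> exp (- 1 * x)" if "x \<in> {1..}" for x
      using that by (simp add: k_def norm_divide norm_exp_eq_Re divide_simps)
  qed
  then obtain I where "(k has_integral I) {1..}" by blast
  then have "((\<lambda>r. E (of_real r) + Ln (of_real r)) \<longlongrightarrow> E (of_real 1) + Ln (of_real 1) + I) at_top"
  proof (rule tendsto_antiderivative_at_top)
    have "continuous_on UNIV E"
      by (auto intro!: continuous_at_imp_continuous_on DERIV_isCont E)
    then have "continuous_on {1..} (\<lambda>r. E (complex_of_real r))"
      by (rule continuous_on_compose2) (auto intro: continuous_intros)
    then show "continuous_on {1..} (\<lambda>r. E (of_real r) + Ln (of_real r))"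
      by (intro continuous_intros) auto
    fix x :: real assume x: "1 < x"
    have "((\<lambda>u. E u + Ln u) has_field_derivative (E' (of_real x) + 1 / of_real x)) (at (of_real x))"
      using x by (auto intro!: derivative_eq_intros E simp: field_simps)
    moreover have "E' (of_real x) + 1 / of_real x = k x"
      using x ode[of "of_real x"] by (simp add: k_def field_simps)
    ultimately show "((\<lambda>r. E (of_real r) + Ln (of_real r)) has_vector_derivative k x) (at x)"
      by (intro has_vector_derivative_real_field) simp
  qed
  moreover have "\<forall>\<^sub>F r in at_top. E (of_real r) + Ln (of_real r) =
      of_real r powr 0 * E (of_real r) + (if 0 = (0::complex) then Ln (of_real r) else 0)"
    using eventually_gt_at_top[of 0] by eventually_elim auto
  ultimately have "((\<lambda>r. of_real r powr 0 * E (of_real r) + (if 0 = (0::complex) then Ln (of_real r) else 0))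
      \<longlongrightarrow> E (of_real 1) + Ln (of_real 1) + I) at_top"
    by (rule Lim_transform_eventually)
  from hankel_integral_from_real_limit[OF \<gamma> E ode this] show ?thesis
    by simp
qed

text \<open>
  Integration by parts: \<open>exp y * y powr (- z)\<close> vanishes at both ends of the contour, so the integral of
  its derivative is \<open>0\<close>.
\<close>

lemma hankel_integral_plus_1:
  assumes \<gamma>: "hankel_contour \<gamma>" and "z \<noteq> 0"
    and z: "((\<lambda>y. exp y * y powr (- z)) has_improper_contour_integral I) \<gamma>"
  shows "((\<lambda>y. exp y * y powr (- (z + 1))) has_improper_contour_integral I / z) \<gamma>"
proof -
  have lim: "((\<lambda>x. exp (\<gamma> x) * \<gamma> x powr (- z)) \<longlongrightarrow> 0) at_top" "((\<lambda>x. exp (\<gamma> x) * \<gamma> x powr (- z)) \<longlongrightarrow> 0) at_bot"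
    using \<gamma> hankel_contour_ends[OF \<gamma>]
    by (auto intro!: tendsto_exp_powr_0 simp: hankel_contour_def elim: eventually_mono)
  have "((\<lambda>y. exp y * y powr (- z) - z * (exp y * y powr (- (z + 1)))) has_improper_contour_integral 0 - 0) \<gamma>"
    by (rule has_improper_contour_integral_primitive[OF \<gamma> _ lim(2) lim(1)])
      (auto intro!: derivative_eq_intros simp: algebra_simps minus_diff_commute)
  from has_improper_contour_integral_add[OF
      has_improper_contour_integral_cmult[OF z, of "1 / z"]
      has_improper_contour_integral_cmult[OF this, of "- 1 / z"]]
  show ?thesis
    using \<open>z \<noteq> 0\<close> by (simp add: field_simps)
qed

theorem hankel_integral_rGamma:
  fixes z :: complex
  assumes \<gamma>: "hankel_contour \<gamma>"
  shows "((\<lambda>y. exp y * y powr (- z)) has_improper_contour_integral 2 * of_real pi * \<i> * rGamma z) \<gamma>"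
proof -
  obtain n :: nat where "Re z < of_nat n"
    using reals_Archimedean2 by blast
  then have "Re z < of_nat n + 1" by simp
  then show ?thesis
  proof (induction n arbitrary: z)
    case 0
    then show ?case using hankel_integral_Re_less_1[OF \<gamma>] by simp
  next
    case (Suc n)
    show ?case
    proof (cases "z = 1")
      case True
      then show ?thesis using hankel_integral_1[OF \<gamma>] by simp
    next
      case False
      have "Re (z - 1) < of_nat n + 1"
        using Suc.prems by simp
      from hankel_integral_plus_1[OF \<gamma> _ Suc.IH[OF this]] False
      have "((\<lambda>y. exp y * y powr (- z)) has_improper_contour_integral
          2 * of_real pi * \<i> * rGamma (z - 1) / (z - 1)) \<gamma>"
        by simp
      moreover have "rGamma (z - 1) / (z - 1) = rGamma z"
        using False rGamma_plus1[of "z - 1"] by (simp add: divide_eq_eq mult.commute)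
      then have "2 * of_real pi * \<i> * rGamma (z - 1) / (z - 1) = 2 * of_real pi * \<i> * rGamma z"
        by (metis times_divide_eq_right)
      ultimately show ?thesis
        by (simp only:)
    qed
  qed
qed

section \<open>Application to the Konhauser polynomials\<close>

text \<open>
  The trinomial coefficient \<open>s! / (k! m! (s - k - m)!)\<close>, with the sign \<open>(-1) ^ (k + m)\<close>, is the Pochhammer symbol
  of \<open>- s\<close> at \<open>k + m\<close>, divided by \<open>k! m!\<close>.
\<close>

lemma trinomial_pochhammer:
  fixes x y :: "'a :: field_char_0"
  shows "(1 - x - y) ^ s =
    (\<Sum>k\<in>{0..s}. \<Sum>m\<in>{0..s - k}. pochhammer (- of_nat s) (k + m) / (fact k * fact m) * x ^ m * y ^ k)"
proof -
  have coeff: "of_nat (s choose k) * of_nat (s - k choose m) * (- 1) ^ (k + m) =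
      pochhammer (- of_nat s) (k + m) / (fact k * fact m :: 'a)" if "k \<le> s" "m \<le> s - k" for k m
  proof -
    have "(s choose k) * (s - k choose m) = (s choose (k + m)) * ((k + m) choose k)"
      using choose_mult[of k "k + m" s] that by simp
    moreover have "((k + m) choose k) * (fact k * fact m) = (fact (k + m) :: nat)"
      using binomial_fact_lemma[of k "k + m"] by (simp add: mult.commute)
    ultimately have "(s choose k) * (s - k choose m) * (fact k * fact m) = (s choose (k + m)) * fact (k + m)"
      by (simp only: mult.assoc)
    from arg_cong[OF this, of "of_nat :: nat \<Rightarrow> 'a"]
    have "of_nat (s choose k) * of_nat (s - k choose m) * (fact k * fact m) =
        (of_nat (s choose (k + m)) * fact (k + m) :: 'a)"
      by (simp only: of_nat_mult of_nat_fact)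
    moreover have "of_nat (s choose (k + m)) * fact (k + m) =
        (- 1) ^ (k + m) * (pochhammer (- of_nat s) (k + m) :: 'a)"
      by (simp add: binomial_gbinomial gbinomial_pochhammer)
    ultimately have "of_nat (s choose k) * of_nat (s - k choose m) * (fact k * fact m) =
        (- 1) ^ (k + m) * (pochhammer (- of_nat s) (k + m) :: 'a)"
      by simp
    then have "of_nat (s choose k) * of_nat (s - k choose m) =
        (- 1) ^ (k + m) * (pochhammer (- of_nat s) (k + m) :: 'a) / (fact k * fact m)"
      by (simp add: eq_divide_eq)
    then show ?thesis
      by (simp add: flip: power_add)
  qed
  have "(1 - x - y) ^ s = (- y + (- x + 1)) ^ s"
    by (simp add: algebra_simps)
  also have "\<dots> = (\<Sum>k\<in>{0..s}. \<Sum>m\<in>{0..s - k}.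
      of_nat (s choose k) * (- y) ^ k * (of_nat (s - k choose m) * (- x) ^ m))"
    unfolding binomial_ring by (simp add: sum_distrib_left atMost_atLeast0)
  also have "\<dots> = (\<Sum>k\<in>{0..s}. \<Sum>m\<in>{0..s - k}.
      of_nat (s choose k) * of_nat (s - k choose m) * (- 1) ^ (k + m) * x ^ m * y ^ k)"
    by (simp add: power_minus[of x] power_minus[of y] power_add mult_ac)
  finally show ?thesis
    by (simp add: coeff)
qed

lemma powr_divide_power:
  fixes y :: complex
  shows "y powr a / y ^ k = y powr (a - of_nat k)"
  by (cases "y = 0") (simp_all add: powr_diff)

theorem theorem28:
  fixes \<upsilon> s :: nat and p q t w :: real and \<gamma>\<^sub>1 \<gamma>\<^sub>2 :: "real \<Rightarrow> complex"
    and F :: "complex \<Rightarrow> complex \<Rightarrow> complex"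
  defines "F \<equiv> \<lambda>y\<^sub>1 y\<^sub>2.
      exp (y\<^sub>1 + y\<^sub>2) * y\<^sub>1 powr of_real (2 * real s - p) * y\<^sub>2 powr of_real (- q - 1) *
      (1 - (of_real w / y\<^sub>2) ^ \<upsilon> - 1 / (of_real t * y\<^sub>1)) ^ s"
  assumes "\<upsilon> \<ge> 1" and "q > -1" and "real s < (p - 1) / 2" and "t \<noteq> 0"
    and "hankel_contour \<gamma>\<^sub>1" and "hankel_contour \<gamma>\<^sub>2"
  shows "(\<forall>y\<^sub>2\<in>range \<gamma>\<^sub>2. (\<lambda>y\<^sub>1. F y\<^sub>1 y\<^sub>2) improper_contour_integrable_on \<gamma>\<^sub>1) \<and>
    (\<lambda>y\<^sub>2. improper_contour_integral \<gamma>\<^sub>1 (\<lambda>y\<^sub>1. F y\<^sub>1 y\<^sub>2)) improper_contour_integrable_on \<gamma>\<^sub>2 \<and>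
    complex_of_real (N_Konhauser s \<upsilon> p q t w) =
      - of_real (Gamma (p - real s) * t ^ s / (4 * pi\<^sup>2)) *
      improper_contour_integral \<gamma>\<^sub>2 (\<lambda>y\<^sub>2. improper_contour_integral \<gamma>\<^sub>1 (\<lambda>y\<^sub>1. F y\<^sub>1 y\<^sub>2))"
proof -
  define a where "a k = p - 2 * real s + real k" for k :: nat
  define b where "b m = q + 1 + real (\<upsilon> * m)" for m :: nat
  define g where "g x y = exp y * y powr (- of_real x)" for x :: real and y :: complex
  define C where "C k m = pochhammer (- real s) (k + m) / (fact k * fact m) * w ^ (\<upsilon> * m) * (1 / t) ^ k"
    for k m
  define J where "J x = 2 * of_real pi * \<i> * complex_of_real (rGamma x)" for x
  have hankel: "(g x has_improper_contour_integral J x) \<gamma>" if "hankel_contour \<gamma>" for x \<gamma>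
    using hankel_integral_rGamma[OF that, of "of_real x"]
    by (simp add: g_def[abs_def] J_def rGamma_complex_of_real)

  have F: "F y\<^sub>1 y\<^sub>2 = (\<Sum>k\<in>{0..s}. \<Sum>m\<in>{0..s - k}. of_real (C k m) * g (b m) y\<^sub>2 * g (a k) y\<^sub>1)" for y\<^sub>1 y\<^sub>2
    unfolding F_def trinomial_pochhammer sum_distrib_left
  proof (intro sum.cong refl)
    fix k m
    have "y\<^sub>1 powr of_real (2 * real s - p) * (1 / (of_real t * y\<^sub>1)) ^ k =
        of_real ((1 / t) ^ k) * (y\<^sub>1 powr of_real (2 * real s - p) / y\<^sub>1 ^ k)"
      by (simp add: power_divide power_mult_distrib)
    also have "\<dots> = of_real ((1 / t) ^ k) * y\<^sub>1 powr (- of_real (a k))"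
    proof -
      have "complex_of_real (2 * real s - p) - of_nat k = - of_real (a k)"
        by (simp add: a_def)
      then show ?thesis
        by (simp only: powr_divide_power)
    qed
    finally have y1: "y\<^sub>1 powr of_real (2 * real s - p) * (1 / (of_real t * y\<^sub>1)) ^ k =
        of_real ((1 / t) ^ k) * y\<^sub>1 powr (- of_real (a k))" .
    have "y\<^sub>2 powr of_real (- q - 1) * ((of_real w / y\<^sub>2) ^ \<upsilon>) ^ m =
        of_real (w ^ (\<upsilon> * m)) * (y\<^sub>2 powr of_real (- q - 1) / y\<^sub>2 ^ (\<upsilon> * m))"
      by (simp add: power_divide flip: power_mult)
    also have "\<dots> = of_real (w ^ (\<upsilon> * m)) * y\<^sub>2 powr (- of_real (b m))"
    proof -
      have "complex_of_real (- q - 1) - of_nat (\<upsilon> * m) = - of_real (b m)"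
        by (simp add: b_def)
      then show ?thesis
        by (simp only: powr_divide_power)
    qed
    finally have y2: "y\<^sub>2 powr of_real (- q - 1) * ((of_real w / y\<^sub>2) ^ \<upsilon>) ^ m =
        of_real (w ^ (\<upsilon> * m)) * y\<^sub>2 powr (- of_real (b m))" .
    have C: "of_real (C k m) = pochhammer (- of_nat s) (k + m) / (fact k * fact m) *
        complex_of_real (w ^ (\<upsilon> * m)) * complex_of_real ((1 / t) ^ k)"
      using pochhammer_of_real[of "- real s" "k + m", where 'a = complex] by (simp add: C_def)
    have "exp (y\<^sub>1 + y\<^sub>2) * y\<^sub>1 powr of_real (2 * real s - p) * y\<^sub>2 powr of_real (- q - 1) *
        (pochhammer (- of_nat s) (k + m) / (fact k * fact m) *
         ((of_real w / y\<^sub>2) ^ \<upsilon>) ^ m * (1 / (of_real t * y\<^sub>1)) ^ k) =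
      pochhammer (- of_nat s) (k + m) / (fact k * fact m) *
        (exp y\<^sub>2 * (y\<^sub>2 powr of_real (- q - 1) * ((of_real w / y\<^sub>2) ^ \<upsilon>) ^ m)) *
        (exp y\<^sub>1 * (y\<^sub>1 powr of_real (2 * real s - p) * (1 / (of_real t * y\<^sub>1)) ^ k))"
      by (simp only: exp_add mult_ac)
    also have "\<dots> = of_real (C k m) * g (b m) y\<^sub>2 * g (a k) y\<^sub>1"
      unfolding y1 y2 C g_def by (simp only: mult_ac)
    finally show "exp (y\<^sub>1 + y\<^sub>2) * y\<^sub>1 powr of_real (2 * real s - p) * y\<^sub>2 powr of_real (- q - 1) *
        (pochhammer (- of_nat s) (k + m) / (fact k * fact m) *
         ((of_real w / y\<^sub>2) ^ \<upsilon>) ^ m * (1 / (of_real t * y\<^sub>1)) ^ k) =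
      of_real (C k m) * g (b m) y\<^sub>2 * g (a k) y\<^sub>1" .
  qed

  have inner: "((\<lambda>y\<^sub>1. F y\<^sub>1 y\<^sub>2) has_improper_contour_integral
      (\<Sum>k\<in>{0..s}. \<Sum>m\<in>{0..s - k}. of_real (C k m) * g (b m) y\<^sub>2 * J (a k))) \<gamma>\<^sub>1" for y\<^sub>2
    unfolding F using \<open>hankel_contour \<gamma>\<^sub>1\<close>
    by (intro has_improper_contour_integral_sum has_improper_contour_integral_cmult hankel)
  have inner_eq: "improper_contour_integral \<gamma>\<^sub>1 (\<lambda>y\<^sub>1. F y\<^sub>1 y\<^sub>2) =
      (\<Sum>k\<in>{0..s}. \<Sum>m\<in>{0..s - k}. of_real (C k m) * J (a k) * g (b m) y\<^sub>2)" for y\<^sub>2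
    using improper_contour_integral_unique[OF inner] by (simp add: mult_ac)
  have outer: "((\<lambda>y\<^sub>2. improper_contour_integral \<gamma>\<^sub>1 (\<lambda>y\<^sub>1. F y\<^sub>1 y\<^sub>2)) has_improper_contour_integral
      (\<Sum>k\<in>{0..s}. \<Sum>m\<in>{0..s - k}. of_real (C k m) * J (a k) * J (b m))) \<gamma>\<^sub>2"
    unfolding inner_eq using \<open>hankel_contour \<gamma>\<^sub>2\<close>
    by (intro has_improper_contour_integral_sum has_improper_contour_integral_cmult hankel)

  have "complex_of_real (N_Konhauser s \<upsilon> p q t w) =
      - of_real (Gamma (p - real s) * t ^ s / (4 * pi\<^sup>2)) *
      (\<Sum>k\<in>{0..s}. \<Sum>m\<in>{0..s - k}. of_real (C k m) * J (a k) * J (b m))"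
  proof -
    have "N_Konhauser s \<upsilon> p q t w = Gamma (p - real s) *
        (\<Sum>k\<in>{0..s}. \<Sum>m\<in>{0..s - k}. t ^ s * (C k m * rGamma (a k) * rGamma (b m)))"
      unfolding N_Konhauser_def
    proof (intro arg_cong2[where f = "(*)"] sum.cong refl)
      fix k m assume "k \<in> {0..s}"
      then have "t ^ (s - k) = t ^ s * (1 / t) ^ k"
        using \<open>t \<noteq> 0\<close> by (simp add: power_diff power_divide)
      then show "pochhammer (- real s) (k + m) * t ^ (s - k) * w ^ (\<upsilon> * m) /
          (Gamma (p - 2 * real s + real k) * Gamma (q + 1 + real (\<upsilon> * m)) * fact k * fact m) =
        t ^ s * (C k m * rGamma (a k) * rGamma (b m))"
        by (simp add: C_def a_def b_def rGamma_inverse_Gamma divide_inverse mult_ac)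
    qed
    moreover have "of_real (C k m) * J (a k) * J (b m) =
        - of_real (4 * pi\<^sup>2) * of_real (C k m * rGamma (a k) * rGamma (b m))" for k m
      by (simp add: J_def power2_eq_square)
    then have "(\<Sum>k\<in>{0..s}. \<Sum>m\<in>{0..s - k}. of_real (C k m) * J (a k) * J (b m)) =
        - of_real (4 * pi\<^sup>2 * (\<Sum>k\<in>{0..s}. \<Sum>m\<in>{0..s - k}. C k m * rGamma (a k) * rGamma (b m)))"
      by (simp add: sum_distrib_left sum_negf)
    ultimately show ?thesis
      by (simp add: sum_distrib_left[symmetric])
  qed
  then show ?thesis
    using inner outer improper_contour_integral_unique[OF outer]
    unfolding improper_contour_integrable_on_def by auto
qed

end
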